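(* Let $A$ and $B$ be local rings, let $V$ be an $A$-$B$-bimodule, and let $$R=\left\{\begin{pmatrix} a & v\\ 0 & b\end{pmatrix} \;\middle|\; a\in A,\ b\in B,\ v\in V\right\}$$ be the formal triangular matrix ring. Then $R$ is very clean if and only if at least one of the following holds: (1) $\frac12\in A$ and $\frac12\in B$; or (2) $R$ is strongly clean.
   Context: All rings are associative with identity, not necessarily commutative; $U(R)$ denotes the group of units of $R$. A ring is local if it has exactly one maximal right ideal. An element $a$ of a ring $R$ is very clean if there exists an idempotent $e\in R$ such that $ae=ea$ and either $a-e\in U(R)$ or $a+e\in U(R)$; $R$ is very clean if every element of $R$ is very clean. An element $a\in R$ is strongly clean if there exist an idempotent $e\in R$ and $u\in U(R)$ with $a=e+u$ and $ae=ea$; $R$ is strongly clean if every element of $R$ is. The condition $\frac12\in A$ means that $2=1+1$ is invertible in $A$. *)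

theory Defs
  imports "HOL-Algebra.Ideal" "HOL-Algebra.Module"
begin

locale right_ideal = additive_subgroup I R + ring R for I and R (structure) +
  assumes I_r_closed: "\<lbrakk>a \<in> I; x \<in> carrier R\<rbrakk> \<Longrightarrow> a \<otimes> x \<in> I"

locale maximal_right_ideal = right_ideal +
  assumes I_notcarr: "carrier R \<noteq> I"
    and I_maximal: "\<lbrakk>right_ideal J R; I \<subseteq> J; J \<subseteq> carrier R\<rbrakk> \<Longrightarrow> J = I \<or> J = carrier R"

locale local_ring = ring R for R (structure) +
  assumes unique_maximal_right_ideal: "\<exists>!I. maximal_right_ideal I R"

definition is_idempotent :: "('a, 'm) ring_scheme \<Rightarrow> 'a \<Rightarrow> bool" where
  "is_idempotent R e \<longleftrightarrow> e \<in> carrier R \<and> e \<otimes>\<^bsub>R\<^esub> e = e"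

definition very_clean_elem :: "('a, 'm) ring_scheme \<Rightarrow> 'a \<Rightarrow> bool" where
  "very_clean_elem R a \<longleftrightarrow>
    (\<exists>e. is_idempotent R e \<and> a \<otimes>\<^bsub>R\<^esub> e = e \<otimes>\<^bsub>R\<^esub> a \<and>
         (a \<ominus>\<^bsub>R\<^esub> e \<in> Units R \<or> a \<oplus>\<^bsub>R\<^esub> e \<in> Units R))"

definition very_clean :: "('a, 'm) ring_scheme \<Rightarrow> bool" where
  "very_clean R \<longleftrightarrow> (\<forall>a\<in>carrier R. very_clean_elem R a)"

definition strongly_clean_elem :: "('a, 'm) ring_scheme \<Rightarrow> 'a \<Rightarrow> bool" where
  "strongly_clean_elem R a \<longleftrightarrow>
    (\<exists>e u. is_idempotent R e \<and> u \<in> Units R \<and>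
           a = e \<oplus>\<^bsub>R\<^esub> u \<and> a \<otimes>\<^bsub>R\<^esub> e = e \<otimes>\<^bsub>R\<^esub> a)"

definition strongly_clean :: "('a, 'm) ring_scheme \<Rightarrow> bool" where
  "strongly_clean R \<longleftrightarrow> (\<forall>a\<in>carrier R. strongly_clean_elem R a)"

(* The library's locale module requires a commutative ring of scalars, so only its record is
   reused: smult is the left action of A.  As for modules, the multiplication and the unit
   inherited from the ring record play no role. *)

record ('a, 'b, 'v) bimodule = "('a, 'v) module" +
  rsmult :: "['v, 'b] \<Rightarrow> 'v" (infixl \<open>\<triangleleft>\<index>\<close> 70)

locale bimodule = A?: ring A + B?: ring B + V?: abelian_group V
  for A (structure) and B (structure) and V (structure) +
  assumes smult_closed [simp, intro]:
      "\<lbrakk>a \<in> carrier A; v \<in> carrier V\<rbrakk> \<Longrightarrow> a \<odot>\<^bsub>V\<^esub> v \<in> carrier V"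
    and smult_l_distr:
      "\<lbrakk>a \<in> carrier A; a' \<in> carrier A; v \<in> carrier V\<rbrakk> \<Longrightarrow>
        (a \<oplus>\<^bsub>A\<^esub> a') \<odot>\<^bsub>V\<^esub> v = (a \<odot>\<^bsub>V\<^esub> v) \<oplus>\<^bsub>V\<^esub> (a' \<odot>\<^bsub>V\<^esub> v)"
    and smult_r_distr:
      "\<lbrakk>a \<in> carrier A; v \<in> carrier V; w \<in> carrier V\<rbrakk> \<Longrightarrow>
        a \<odot>\<^bsub>V\<^esub> (v \<oplus>\<^bsub>V\<^esub> w) = (a \<odot>\<^bsub>V\<^esub> v) \<oplus>\<^bsub>V\<^esub> (a \<odot>\<^bsub>V\<^esub> w)"
    and smult_assoc:
      "\<lbrakk>a \<in> carrier A; a' \<in> carrier A; v \<in> carrier V\<rbrakk> \<Longrightarrow>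
        (a \<otimes>\<^bsub>A\<^esub> a') \<odot>\<^bsub>V\<^esub> v = a \<odot>\<^bsub>V\<^esub> (a' \<odot>\<^bsub>V\<^esub> v)"
    and smult_one [simp]:
      "v \<in> carrier V \<Longrightarrow> \<one>\<^bsub>A\<^esub> \<odot>\<^bsub>V\<^esub> v = v"
    and rsmult_closed [simp, intro]:
      "\<lbrakk>v \<in> carrier V; b \<in> carrier B\<rbrakk> \<Longrightarrow> v \<triangleleft>\<^bsub>V\<^esub> b \<in> carrier V"
    and rsmult_r_distr:
      "\<lbrakk>v \<in> carrier V; b \<in> carrier B; b' \<in> carrier B\<rbrakk> \<Longrightarrow>
        v \<triangleleft>\<^bsub>V\<^esub> (b \<oplus>\<^bsub>B\<^esub> b') = (v \<triangleleft>\<^bsub>V\<^esub> b) \<oplus>\<^bsub>V\<^esub> (v \<triangleleft>\<^bsub>V\<^esub> b')"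
    and rsmult_l_distr:
      "\<lbrakk>v \<in> carrier V; w \<in> carrier V; b \<in> carrier B\<rbrakk> \<Longrightarrow>
        (v \<oplus>\<^bsub>V\<^esub> w) \<triangleleft>\<^bsub>V\<^esub> b = (v \<triangleleft>\<^bsub>V\<^esub> b) \<oplus>\<^bsub>V\<^esub> (w \<triangleleft>\<^bsub>V\<^esub> b)"
    and rsmult_assoc:
      "\<lbrakk>v \<in> carrier V; b \<in> carrier B; b' \<in> carrier B\<rbrakk> \<Longrightarrow>
        v \<triangleleft>\<^bsub>V\<^esub> (b \<otimes>\<^bsub>B\<^esub> b') = (v \<triangleleft>\<^bsub>V\<^esub> b) \<triangleleft>\<^bsub>V\<^esub> b'"
    and rsmult_one [simp]:
      "v \<in> carrier V \<Longrightarrow> v \<triangleleft>\<^bsub>V\<^esub> \<one>\<^bsub>B\<^esub> = v"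
    and smult_rsmult:
      "\<lbrakk>a \<in> carrier A; v \<in> carrier V; b \<in> carrier B\<rbrakk> \<Longrightarrow>
        (a \<odot>\<^bsub>V\<^esub> v) \<triangleleft>\<^bsub>V\<^esub> b = a \<odot>\<^bsub>V\<^esub> (v \<triangleleft>\<^bsub>V\<^esub> b)"

(* The triple (a, v, b) stands for the matrix with rows (a v) and (0 b). *)

definition triangular_ring ::
  "('a, 'm) ring_scheme \<Rightarrow> ('b, 'n) ring_scheme \<Rightarrow> ('a, 'b, 'v, 'k) bimodule_scheme \<Rightarrow>
   ('a \<times> 'v \<times> 'b) ring" where
  "triangular_ring A B V =
    \<lparr>carrier = carrier A \<times> carrier V \<times> carrier B,
     mult = (\<lambda>(a, v, b) (a', v', b').
       (a \<otimes>\<^bsub>A\<^esub> a', (a \<odot>\<^bsub>V\<^esub> v') \<oplus>\<^bsub>V\<^esub> (v \<triangleleft>\<^bsub>V\<^esub> b'), b \<otimes>\<^bsub>B\<^esub> b')),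
     one = (\<one>\<^bsub>A\<^esub>, \<zero>\<^bsub>V\<^esub>, \<one>\<^bsub>B\<^esub>),
     zero = (\<zero>\<^bsub>A\<^esub>, \<zero>\<^bsub>V\<^esub>, \<zero>\<^bsub>B\<^esub>),
     add = (\<lambda>(a, v, b) (a', v', b'). (a \<oplus>\<^bsub>A\<^esub> a', v \<oplus>\<^bsub>V\<^esub> v', b \<oplus>\<^bsub>B\<^esub> b'))\<rparr>"

context bimodule
begin

lemma smult_zero [simp]:
  assumes "a \<in> carrier A" shows "a \<odot>\<^bsub>V\<^esub> \<zero>\<^bsub>V\<^esub> = \<zero>\<^bsub>V\<^esub>"
  using smult_r_distr[OF assms V.zero_closed V.zero_closed] assms
  by (metis V.add.l_cancel_one' V.l_zero V.zero_closed smult_closed)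

lemma zero_rsmult [simp]:
  assumes "b \<in> carrier B" shows "\<zero>\<^bsub>V\<^esub> \<triangleleft>\<^bsub>V\<^esub> b = \<zero>\<^bsub>V\<^esub>"
  using rsmult_l_distr[OF V.zero_closed V.zero_closed assms] assms
  by (metis V.add.l_cancel_one' V.l_zero V.zero_closed rsmult_closed)

lemma triangular_ring_is_ring: "ring (triangular_ring A B V)"
proof (intro ringI abelian_groupI monoidI, goal_cases)
  case (6 x)
  then obtain a v b where x: "x = (a, v, b)" "a \<in> carrier A" "v \<in> carrier V" "b \<in> carrier B"
    by (auto simp: triangular_ring_def)
  then show ?case
    by (intro bexI[of _ "(\<ominus>\<^bsub>A\<^esub> a, \<ominus>\<^bsub>V\<^esub> v, \<ominus>\<^bsub>B\<^esub> b)"])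
      (auto simp: triangular_ring_def A.l_neg B.l_neg V.l_neg)
qed (auto simp: triangular_ring_def A.a_ac B.a_ac V.a_ac A.m_assoc B.m_assoc
    A.l_distr B.l_distr A.r_distr B.r_distr smult_l_distr smult_r_distr smult_assoc
    rsmult_l_distr rsmult_r_distr rsmult_assoc smult_rsmult)

end

end

theory Submission
  imports Defs
begin

text \<open>
  Since \<open>-r - e = -(r + e)\<close>, an element \<open>r\<close> is very clean exactly when \<open>r\<close> or \<open>-r\<close> is strongly
  clean; in particular strongly clean rings are very clean.  In a triangular ring invertibility is
  read off the diagonal, and the diagonal of an idempotent consists of idempotents, which in a local
  ring are 0 and 1 only.

  If 2 is invertible in both rings, the idempotents 0 and 1 are enough: 0 works when both diagonal
  entries are units, and otherwise one of \<open>r - 1\<close>, \<open>r + 1\<close> is invertible, because \<open>x - 1\<close> and \<open>x + 1\<close>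
  are both invertible for a nonunit \<open>x\<close>, while for any \<open>x\<close> their difference 2 is a unit, so that at
  least one of them is (\<open>very_clean_if_two_Units\<close>).

  Conversely, let the triangular ring be very clean and let 2 be a nonunit of, say, \<open>A\<close>.  An idempotent
  \<open>p\<close> of \<open>A\<close> for which \<open>a + p\<close> is a unit then makes \<open>a - p\<close> a unit as well, the two differing by
  0 or by the nonunit 2.  In \<open>B\<close> the same passage from plus to minus succeeds for a nonunit \<open>b\<close>:
  if \<open>b + q\<close> is a unit then \<open>q = 1\<close>, and \<open>b - 1\<close> is always a unit.  So every matrix
  whose entry \<open>b\<close> is a nonunit is strongly clean, by the very idempotent that makes it very clean
  (\<open>very_clean_elem_imp_strongly_clean_elem\<close>).  The reflection \<open>r \<mapsto> 1 - r\<close> preserves strong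
  cleanness (\<open>strongly_clean_elem_one_minus\<close>) and settles the matrices for which \<open>1 - b\<close> is a
  nonunit.  If both \<open>b\<close> and \<open>1 - b\<close> are units, one of the idempotents 0 and 1 serves, the choice
  being dictated by \<open>a\<close>.  The reflection is what makes one ring suffice: it exchanges the two mixed
  cases, in which one diagonal entry is a unit and the other is not.
\<close>

section \<open>Local rings\<close>

text \<open>Zorn's lemma applies because a right ideal is proper exactly when it misses \<open>\<one>\<close>, a condition that
  survives unions of chains.\<close>

lemma (in ring) proper_right_ideal_extends_to_maximal:
  assumes I: "right_ideal I R" and "\<one> \<notin> I"
  obtains M where "maximal_right_ideal M R" and "I \<subseteq> M"
proof -
  define P where "P = {J. right_ideal J R \<and> I \<subseteq> J \<and> \<one> \<notin> J}"
  have "I \<in> P"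
    using assms by (simp add: P_def)
  have "\<Union>C \<in> P" if "C \<noteq> {}" and C: "subset.chain P C" for C
  proof -
    have ri: "right_ideal J R" and IJ: "I \<subseteq> J" and oneJ: "\<one> \<notin> J" if "J \<in> C" for J
      using C that by (auto simp: P_def subset_chain_def)
    have J_sub: "J \<subseteq> carrier R" and J_zero: "\<zero> \<in> J"
      and J_neg: "a \<in> J \<Longrightarrow> \<ominus> a \<in> J" and J_add: "a \<in> J \<Longrightarrow> b \<in> J \<Longrightarrow> a \<oplus> b \<in> J"
      and J_mult: "a \<in> J \<Longrightarrow> x \<in> carrier R \<Longrightarrow> a \<otimes> x \<in> J" if "J \<in> C" for J a b x
    proof -
      interpret J: right_ideal J R
        using ri[OF that] .
      show "J \<subseteq> carrier R" "\<zero> \<in> J" "a \<in> J \<Longrightarrow> \<ominus> a \<in> J"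
        "a \<in> J \<Longrightarrow> b \<in> J \<Longrightarrow> a \<oplus> b \<in> J" "a \<in> J \<Longrightarrow> x \<in> carrier R \<Longrightarrow> a \<otimes> x \<in> J"
        using J.a_subset J.I_r_closed by auto
    qed
    obtain J0 where J0: "J0 \<in> C"
      using \<open>C \<noteq> {}\<close> by blast
    have "subgroup (\<Union>C) (add_monoid R)"
    proof (rule add.subgroupI)
      show "\<Union>C \<subseteq> carrier R"
        using J_sub by blast
      show "\<Union>C \<noteq> {}"
        using J0 J_zero by blast
      show "\<ominus> a \<in> \<Union>C" if "a \<in> \<Union>C" for a
        using that J_neg by blast
      fix a b assume "a \<in> \<Union>C" "b \<in> \<Union>C"
      then obtain Ja Jb where J: "Ja \<in> C" "Jb \<in> C" "a \<in> Ja" "b \<in> Jb"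
        by blast
      then have "Ja \<subseteq> Jb \<or> Jb \<subseteq> Ja"
        using C by (auto simp: subset_chain_def)
      then show "a \<oplus> b \<in> \<Union>C"
        using J J_add by blast
    qed
    then have "right_ideal (\<Union>C) R"
      using J_mult by (simp add: right_ideal_def right_ideal_axioms_def additive_subgroup_def ring_axioms) blast
    then show ?thesis
      using IJ oneJ J0 by (auto simp: P_def)
  qed
  then obtain M where M: "M \<in> P" and max: "\<And>J. J \<in> P \<Longrightarrow> M \<subseteq> J \<Longrightarrow> J = M"
    using subset_Zorn_nonempty[of P] \<open>I \<in> P\<close> by (metis empty_iff)
  interpret M: right_ideal M R
    using M by (simp add: P_def)
  have "maximal_right_ideal M R"
  proof
    show "carrier R \<noteq> M"
      using M by (auto simp: P_def)
    fix J assume J: "right_ideal J R" "M \<subseteq> J" "J \<subseteq> carrier R"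
    interpret J: right_ideal J R by fact
    show "J = M \<or> J = carrier R"
    proof (cases "\<one> \<in> J")
      case True
      then have "x \<in> J" if "x \<in> carrier R" for x
        using J.I_r_closed[OF True that] that by simp
      then show ?thesis
        using J by blast
    next
      case False
      then show ?thesis
        using max[of J] J M by (auto simp: P_def)
    qed
  qed
  then show thesis
    using that M by (auto simp: P_def)
qed

lemma (in ring) right_ideal_principal:
  assumes "x \<in> carrier R"
  shows "right_ideal ((\<lambda>r. x \<otimes> r) ` carrier R) R"
proof -
  let ?xR = "(\<lambda>r. x \<otimes> r) ` carrier R"
  have "subgroup ?xR (add_monoid R)"
  proof (rule add.subgroupI)
    show "\<ominus> a \<in> ?xR" if a: "a \<in> ?xR" for a
    proof -
      obtain r where "r \<in> carrier R" "a = x \<otimes> r"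
        using a by blast
      then show ?thesis
        using assms by (intro image_eqI[of _ _ "\<ominus> r"]) (auto simp: r_minus)
    qed
    show "a \<oplus> b \<in> ?xR" if ab: "a \<in> ?xR" "b \<in> ?xR" for a b
    proof -
      obtain r s where "r \<in> carrier R" "a = x \<otimes> r" "s \<in> carrier R" "b = x \<otimes> s"
        using ab by blast
      then show ?thesis
        using assms by (intro image_eqI[of _ _ "r \<oplus> s"]) (auto simp: r_distr)
    qed
  qed (use assms in auto)
  moreover have "a \<otimes> s \<in> ?xR" if a: "a \<in> ?xR" and "s \<in> carrier R" for a s
  proof -
    obtain r where "r \<in> carrier R" "a = x \<otimes> r"
      using a by blast
    then show ?thesis
      using assms that by (intro image_eqI[of _ _ "r \<otimes> s"]) (auto simp: m_assoc)
  qed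
  ultimately show ?thesis
    by (simp add: right_ideal_def right_ideal_axioms_def additive_subgroup_def ring_axioms)
qed

lemma (in ring) Units_minus_iff:
  assumes "x \<in> carrier R"
  shows "\<ominus> x \<in> Units R \<longleftrightarrow> x \<in> Units R"
proof -
  have "\<ominus> u \<in> Units R" if u: "u \<in> Units R" for u
  proof -
    obtain w where "w \<in> carrier R" "u \<otimes> w = \<one>" "w \<otimes> u = \<one>"
      using u by (auto simp: Units_def)
    then show ?thesis
      using Units_closed[OF u]
      by (auto simp: Units_def l_minus r_minus intro!: bexI[of _ "\<ominus> w"])
  qed
  then show ?thesis
    using assms by (metis minus_minus)
qed

context local_ring
begin

text \<open>An element \<open>x\<close> outside the unique maximal right ideal \<open>M\<close> generates a right ideal lying in no
  maximal one, so it has a right inverse \<open>y\<close>.  That \<open>y\<close> inverts \<open>x\<close> on both sides follows once \<open>y\<close> too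
  is outside \<open>M\<close>, and hence has a right inverse of its own.\<close>

lemma maximal_right_ideal_is_nonunits:
  assumes M: "maximal_right_ideal M R"
  shows "M = carrier R - Units R"
proof -
  interpret M: maximal_right_ideal M R by fact
  have one: "\<one> \<notin> M"
  proof
    assume "\<one> \<in> M"
    then have "x \<in> M" if "x \<in> carrier R" for x
      using M.I_r_closed[OF _ that] that by fastforce
    then show False
      using M.I_notcarr M.a_subset by blast
  qed
  have right_inverse: "\<exists>y\<in>carrier R. x \<otimes> y = \<one>" if x: "x \<in> carrier R" "x \<notin> M" for x
  proof (rule ccontr)
    assume "\<not> ?thesis"
    then have "\<one> \<notin> (\<lambda>r. x \<otimes> r) ` carrier R"
      by auto
    then obtain N where N: "maximal_right_ideal N R" "(\<lambda>r. x \<otimes> r) ` carrier R \<subseteq> N"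
      using proper_right_ideal_extends_to_maximal right_ideal_principal x by metis
    moreover have "x \<in> (\<lambda>r. x \<otimes> r) ` carrier R"
      using x by (intro image_eqI[of _ _ "\<one>"]) auto
    moreover have "N = M"
      using unique_maximal_right_ideal M N(1) by (metis (no_types))
    ultimately show False
      using x by blast
  qed
  have "x \<in> Units R" if x: "x \<in> carrier R" "x \<notin> M" for x
  proof -
    obtain y where y: "y \<in> carrier R" "x \<otimes> y = \<one>"
      using right_inverse[OF x] by blast
    have "y \<notin> M"
    proof
      assume "y \<in> M"
      \<comment> \<open>Otherwise \<open>\<one> \<ominus> y \<otimes> x\<close>, which \<open>x\<close> annihilates from the left, would be right invertible.\<close>
      then have yx: "y \<otimes> x \<in> M"
        using M.I_r_closed x by blast
      have "\<one> = (\<one> \<ominus> y \<otimes> x) \<oplus> y \<otimes> x"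
        using x y by algebra
      then have "\<one> \<ominus> y \<otimes> x \<notin> M"
        using yx one M.a_closed by metis
      then obtain z where z: "z \<in> carrier R" "(\<one> \<ominus> y \<otimes> x) \<otimes> z = \<one>"
        using right_inverse x y by (meson minus_closed m_closed one_closed)
      have "x \<otimes> (\<one> \<ominus> y \<otimes> x) = x \<ominus> (x \<otimes> y) \<otimes> x"
        using x y(1) by (simp add: a_minus_def r_distr r_minus m_assoc)
      also have "\<dots> = \<zero>"
        using x y by (simp add: a_minus_def r_neg)
      finally have "x \<otimes> ((\<one> \<ominus> y \<otimes> x) \<otimes> z) = \<zero>"
        using x y(1) z(1) by (metis l_null m_assoc m_closed minus_closed one_closed)
      then have "x = \<zero>"
        using x z by simp
      then show False
        using x(2) M.zero_closed by simp
    qed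
    then obtain w where w: "w \<in> carrier R" "y \<otimes> w = \<one>"
      using right_inverse y by blast
    then have "w = x"
      using x y by (metis l_one m_assoc r_one)
    then show ?thesis
      using x y w by (auto simp: Units_def)
  qed
  moreover have "x \<notin> M" if "x \<in> Units R" for x
    using that one M.I_r_closed Units_r_inv Units_inv_closed by metis
  ultimately show ?thesis
    using M.a_subset by blast
qed

text \<open>The only consequence of locality used from here on: the nonunits are closed under addition.\<close>

lemma Units_add_cases:
  assumes "x \<in> carrier R" "y \<in> carrier R" "x \<oplus> y \<in> Units R"
  obtains "x \<in> Units R" | "y \<in> Units R"
proof -
  obtain M where "maximal_right_ideal M R"
    using unique_maximal_right_ideal by blast
  then interpret M: maximal_right_ideal M R .
  have M: "M = carrier R - Units R"
    using maximal_right_ideal_is_nonunits M.maximal_right_ideal_axioms .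
  then show thesis
    using M.a_closed[of x y] assms that by blast
qed

lemma idempotent_cases:
  assumes "is_idempotent R e"
  obtains "e = \<zero>" | "e = \<one>"
proof -
  have e: "e \<in> carrier R" "e \<otimes> e = e"
    using assms by (auto simp: is_idempotent_def)
  have "e \<oplus> (\<one> \<ominus> e) = \<one>"
    using e(1) by algebra
  then consider "e \<in> Units R" | "\<one> \<ominus> e \<in> Units R"
    using Units_add_cases[of e "\<one> \<ominus> e"] e(1) by auto
  then show thesis
  proof cases
    case 1
    then show ?thesis
      using that(2) e by (metis Units_l_cancel one_closed r_one)
  next
    case 2
    have "(\<one> \<ominus> e) \<otimes> e = (\<one> \<ominus> e) \<otimes> \<zero>"
      using e by (simp add: a_minus_def l_distr l_minus r_neg)
    then show ?thesis
      using that(1) 2 e by (metis Units_l_cancel zero_closed)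
  qed
qed

lemma nonunit_minus_one_Unit:
  assumes "x \<in> carrier R" "x \<notin> Units R"
  shows "x \<ominus> \<one> \<in> Units R"
proof -
  have "\<one> = x \<oplus> (\<ominus> (x \<ominus> \<one>))"
    using assms by algebra
  then have "\<ominus> (x \<ominus> \<one>) \<in> Units R"
    using assms Units_add_cases[of x "\<ominus> (x \<ominus> \<one>)"] by auto
  then show ?thesis
    using assms Units_minus_iff by auto
qed

lemma nonunit_plus_one_Unit:
  assumes "x \<in> carrier R" "x \<notin> Units R"
  shows "x \<oplus> \<one> \<in> Units R"
proof -
  have "\<one> = (\<ominus> x) \<oplus> (x \<oplus> \<one>)"
    using assms by algebra
  then show ?thesis
    using assms Units_add_cases[of "\<ominus> x" "x \<oplus> \<one>"] Units_minus_iff by auto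
qed

text \<open>This transfers very cleanness to strong cleanness on each diagonal entry.  Only \<open>e = \<one>\<close> needs an
  argument: for a nonunit \<open>x\<close> the element \<open>x \<ominus> \<one>\<close> is always a unit, and if 2 is a nonunit then
  adding it to \<open>x \<ominus> \<one>\<close> cannot turn a nonunit into a unit.\<close>

lemma plus_idempotent_Unit_imp_minus_Unit:
  assumes "x \<in> carrier R" "is_idempotent R e" "x \<oplus> e \<in> Units R"
    and "x \<notin> Units R \<or> \<one> \<oplus> \<one> \<notin> Units R"
  shows "x \<ominus> e \<in> Units R"
  using \<open>is_idempotent R e\<close>
proof (cases rule: idempotent_cases)
  case 1
  then show ?thesis
    using assms by (simp add: a_minus_def)
next
  case 2
  show ?thesis
  proof (cases "x \<in> Units R")
    case True
    have "x \<oplus> \<one> = (x \<ominus> \<one>) \<oplus> (\<one> \<oplus> \<one>)"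
      using assms(1) by algebra
    then show ?thesis
      using assms 2 True Units_add_cases[of "x \<ominus> \<one>" "\<one> \<oplus> \<one>"] by auto
  next
    case False
    then show ?thesis
      using nonunit_minus_one_Unit assms(1) 2 by simp
  qed
qed

lemma minus_or_plus_one_Unit:
  assumes "x \<in> carrier R" "\<one> \<oplus> \<one> \<in> Units R"
  obtains "x \<ominus> \<one> \<in> Units R" | "x \<oplus> \<one> \<in> Units R"
proof -
  have "(x \<oplus> \<one>) \<oplus> (\<ominus> (x \<ominus> \<one>)) = \<one> \<oplus> \<one>"
    using assms(1) by algebra
  then show thesis
    using that assms Units_add_cases[of "x \<oplus> \<one>" "\<ominus> (x \<ominus> \<one>)"] Units_minus_iff by auto
qed

end

section \<open>Strongly clean elements\<close>

context ring
begin

lemma strongly_clean_elem_iff: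
  assumes "a \<in> carrier R"
  shows "strongly_clean_elem R a \<longleftrightarrow>
    (\<exists>e. is_idempotent R e \<and> a \<otimes> e = e \<otimes> a \<and> a \<ominus> e \<in> Units R)"
proof
  assume "strongly_clean_elem R a"
  then obtain e u where eu: "is_idempotent R e" "u \<in> Units R" "a = e \<oplus> u" "a \<otimes> e = e \<otimes> a"
    by (auto simp: strongly_clean_elem_def)
  then have "u = a \<ominus> e"
    using Units_closed[OF eu(2)] unfolding is_idempotent_def by algebra
  then show "\<exists>e. is_idempotent R e \<and> a \<otimes> e = e \<otimes> a \<and> a \<ominus> e \<in> Units R"
    using eu by blast
next
  assume "\<exists>e. is_idempotent R e \<and> a \<otimes> e = e \<otimes> a \<and> a \<ominus> e \<in> Units R"
  then obtain e where e: "is_idempotent R e" "a \<otimes> e = e \<otimes> a" "a \<ominus> e \<in> Units R"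
    by blast
  have "a = e \<oplus> (a \<ominus> e)"
    using e(1) assms unfolding is_idempotent_def by algebra
  then show "strongly_clean_elem R a"
    using e by (auto simp: strongly_clean_elem_def)
qed

text \<open>If \<open>e\<close> witnesses strong cleanness of \<open>\<one> \<ominus> a\<close>, then \<open>\<one> \<ominus> e\<close> does so for \<open>a\<close>, since
  \<open>a \<ominus> (\<one> \<ominus> e)\<close> is the negative of \<open>(\<one> \<ominus> a) \<ominus> e\<close>.\<close>

lemma strongly_clean_elem_one_minus:
  assumes a: "a \<in> carrier R" and "strongly_clean_elem R (\<one> \<ominus> a)"
  shows "strongly_clean_elem R a"
proof -
  obtain e where e: "e \<in> carrier R" "e \<otimes> e = e" "(\<one> \<ominus> a) \<otimes> e = e \<otimes> (\<one> \<ominus> a)"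
      "(\<one> \<ominus> a) \<ominus> e \<in> Units R"
    using assms strongly_clean_elem_iff[of "\<one> \<ominus> a"] by (auto simp: is_idempotent_def)
  have "\<ominus> (a \<otimes> e) = \<ominus> (e \<otimes> a)"
    using e(3) a e(1) by (simp add: a_minus_def l_distr r_distr l_minus r_minus)
  then have ae: "a \<otimes> e = e \<otimes> a"
    using a e(1) by (metis m_closed minus_minus)
  have "(\<one> \<ominus> e) \<otimes> (\<one> \<ominus> e) = \<one> \<ominus> e"
    using e(1,2) by (simp add: a_minus_def l_distr r_distr l_minus r_minus r_neg)
  moreover have "a \<otimes> (\<one> \<ominus> e) = (\<one> \<ominus> e) \<otimes> a"
    using a e(1) ae by (simp add: a_minus_def l_distr r_distr l_minus r_minus)
  moreover have "a \<ominus> (\<one> \<ominus> e) = \<ominus> ((\<one> \<ominus> a) \<ominus> e)"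
    using a e(1) by algebra
  moreover have "\<ominus> ((\<one> \<ominus> a) \<ominus> e) \<in> Units R"
    using e(4) a e(1) Units_minus_iff by simp
  ultimately show ?thesis
    using e(1) a
    by (auto simp: strongly_clean_elem_iff is_idempotent_def intro!: exI[of _ "\<one> \<ominus> e"])
qed

lemma strongly_clean_imp_very_clean:
  "strongly_clean R \<Longrightarrow> very_clean R"
  by (auto simp: strongly_clean_def very_clean_def very_clean_elem_def strongly_clean_elem_iff)

end

section \<open>Triangular rings\<close>

locale local_bimodule = bimodule A B V + A?: local_ring A + B?: local_ring B
  for A (structure) and B (structure) and V (structure)
begin

abbreviation T where "T \<equiv> triangular_ring A B V"

sublocale T: ring T
  by (rule triangular_ring_is_ring)

lemma carrier_T: "carrier T = carrier A \<times> carrier V \<times> carrier B"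
  by (simp add: triangular_ring_def)

lemma add_T: "(a, v, b) \<oplus>\<^bsub>T\<^esub> (a', v', b') = (a \<oplus>\<^bsub>A\<^esub> a', v \<oplus>\<^bsub>V\<^esub> v', b \<oplus>\<^bsub>B\<^esub> b')"
  by (simp add: triangular_ring_def)

lemma mult_T: "(a, v, b) \<otimes>\<^bsub>T\<^esub> (a', v', b') =
    (a \<otimes>\<^bsub>A\<^esub> a', (a \<odot>\<^bsub>V\<^esub> v') \<oplus>\<^bsub>V\<^esub> (v \<triangleleft>\<^bsub>V\<^esub> b'), b \<otimes>\<^bsub>B\<^esub> b')"
  by (simp add: triangular_ring_def)

lemma one_T: "\<one>\<^bsub>T\<^esub> = (\<one>\<^bsub>A\<^esub>, \<zero>\<^bsub>V\<^esub>, \<one>\<^bsub>B\<^esub>)"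
  by (simp add: triangular_ring_def)

lemma zero_T: "\<zero>\<^bsub>T\<^esub> = (\<zero>\<^bsub>A\<^esub>, \<zero>\<^bsub>V\<^esub>, \<zero>\<^bsub>B\<^esub>)"
  by (simp add: triangular_ring_def)

lemma minus_T:
  assumes "a \<in> carrier A" "v \<in> carrier V" "b \<in> carrier B"
    and "a' \<in> carrier A" "v' \<in> carrier V" "b' \<in> carrier B"
  shows "(a, v, b) \<ominus>\<^bsub>T\<^esub> (a', v', b') = (a \<ominus>\<^bsub>A\<^esub> a', v \<ominus>\<^bsub>V\<^esub> v', b \<ominus>\<^bsub>B\<^esub> b')"
proof -
  have "\<ominus>\<^bsub>T\<^esub> (a', v', b') = (\<ominus>\<^bsub>A\<^esub> a', \<ominus>\<^bsub>V\<^esub> v', \<ominus>\<^bsub>B\<^esub> b')"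
    by (rule T.minus_equality)
      (use assms in \<open>auto simp: add_T zero_T carrier_T A.l_neg B.l_neg V.l_neg\<close>)
  then show ?thesis
    by (simp add: T.minus_eq A.minus_eq B.minus_eq V.minus_eq add_T)
qed

lemma Units_T_iff:
  assumes "a \<in> carrier A" "v \<in> carrier V" "b \<in> carrier B"
  shows "(a, v, b) \<in> Units T \<longleftrightarrow> a \<in> Units A \<and> b \<in> Units B"
proof
  assume "(a, v, b) \<in> Units T"
  then show "a \<in> Units A \<and> b \<in> Units B"
    using assms by (force simp: Units_def carrier_T mult_T one_T)
next
  assume "a \<in> Units A \<and> b \<in> Units B"
  then obtain a' b' where a': "a' \<in> carrier A" "a \<otimes>\<^bsub>A\<^esub> a' = \<one>\<^bsub>A\<^esub>" "a' \<otimes>\<^bsub>A\<^esub> a = \<one>\<^bsub>A\<^esub>"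
    and b': "b' \<in> carrier B" "b \<otimes>\<^bsub>B\<^esub> b' = \<one>\<^bsub>B\<^esub>" "b' \<otimes>\<^bsub>B\<^esub> b = \<one>\<^bsub>B\<^esub>"
    by (auto simp: Units_def)
  \<comment> \<open>The corner entry of the inverse matrix is \<open>\<ominus>(a' v b')\<close>.\<close>
  define w where "w = a' \<odot>\<^bsub>V\<^esub> (\<ominus>\<^bsub>V\<^esub> v \<triangleleft>\<^bsub>V\<^esub> b')"
  have w: "w \<in> carrier V"
    using assms a' b' by (simp add: w_def)
  have neg_l: "\<ominus>\<^bsub>V\<^esub> v \<triangleleft>\<^bsub>V\<^esub> b' \<oplus>\<^bsub>V\<^esub> v \<triangleleft>\<^bsub>V\<^esub> b' = \<zero>\<^bsub>V\<^esub>"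
    using assms b' by (simp add: rsmult_l_distr[symmetric] V.l_neg)
  have neg_r: "a' \<odot>\<^bsub>V\<^esub> v \<oplus>\<^bsub>V\<^esub> a' \<odot>\<^bsub>V\<^esub> (\<ominus>\<^bsub>V\<^esub> v) = \<zero>\<^bsub>V\<^esub>"
    using assms a' by (simp add: smult_r_distr[symmetric] V.r_neg)
  have aw: "a \<odot>\<^bsub>V\<^esub> w = \<ominus>\<^bsub>V\<^esub> v \<triangleleft>\<^bsub>V\<^esub> b'"
    using assms a' b' by (simp add: w_def smult_assoc[symmetric])
  have wb: "w \<triangleleft>\<^bsub>V\<^esub> b = a' \<odot>\<^bsub>V\<^esub> (\<ominus>\<^bsub>V\<^esub> v)"
    using assms a' b' by (simp add: w_def smult_rsmult rsmult_assoc[symmetric])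
  have "(a, v, b) \<otimes>\<^bsub>T\<^esub> (a', w, b') = \<one>\<^bsub>T\<^esub>" "(a', w, b') \<otimes>\<^bsub>T\<^esub> (a, v, b) = \<one>\<^bsub>T\<^esub>"
    using a' b' by (simp_all add: mult_T one_T aw wb neg_l neg_r)
  then show "(a, v, b) \<in> Units T"
    using assms a' b' w unfolding Units_def carrier_T by blast
qed

lemma idempotent_T_diagonal:
  assumes "is_idempotent T (p, x, q)"
  shows "is_idempotent A p" "is_idempotent B q"
  using assms by (auto simp: is_idempotent_def carrier_T mult_T)

text \<open>The idempotent stays the same, so the commutation condition carries over unchanged and only
  the two diagonal entries have to be compared.\<close>

lemma very_clean_elem_imp_strongly_clean_elem:
  assumes "very_clean_elem T (a, v, b)"
    and abv: "a \<in> carrier A" "v \<in> carrier V" "b \<in> carrier B"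
    and A: "a \<notin> Units A \<or> \<one>\<^bsub>A\<^esub> \<oplus>\<^bsub>A\<^esub> \<one>\<^bsub>A\<^esub> \<notin> Units A"
    and B: "b \<notin> Units B \<or> \<one>\<^bsub>B\<^esub> \<oplus>\<^bsub>B\<^esub> \<one>\<^bsub>B\<^esub> \<notin> Units B"
  shows "strongly_clean_elem T (a, v, b)"
proof -
  obtain p x q where e: "is_idempotent T (p, x, q)"
      "(a, v, b) \<otimes>\<^bsub>T\<^esub> (p, x, q) = (p, x, q) \<otimes>\<^bsub>T\<^esub> (a, v, b)"
    and u: "(a, v, b) \<ominus>\<^bsub>T\<^esub> (p, x, q) \<in> Units T \<or> (a, v, b) \<oplus>\<^bsub>T\<^esub> (p, x, q) \<in> Units T"
    using assms(1) unfolding very_clean_elem_def by (metis prod_cases3)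
  have pxq: "p \<in> carrier A" "x \<in> carrier V" "q \<in> carrier B"
    using e by (auto simp: is_idempotent_def carrier_T)
  have "(a, v, b) \<ominus>\<^bsub>T\<^esub> (p, x, q) \<in> Units T"
    using u
  proof
    assume "(a, v, b) \<oplus>\<^bsub>T\<^esub> (p, x, q) \<in> Units T"
    then have "a \<oplus>\<^bsub>A\<^esub> p \<in> Units A" "b \<oplus>\<^bsub>B\<^esub> q \<in> Units B"
      using abv pxq by (auto simp: add_T Units_T_iff)
    then have "a \<ominus>\<^bsub>A\<^esub> p \<in> Units A" "b \<ominus>\<^bsub>B\<^esub> q \<in> Units B"
      using A.plus_idempotent_Unit_imp_minus_Unit B.plus_idempotent_Unit_imp_minus_Unit
        idempotent_T_diagonal[OF e(1)] abv A B by auto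
    then show ?thesis
      using abv pxq by (simp add: minus_T Units_T_iff)
  qed
  then show ?thesis
    using e abv by (auto simp: T.strongly_clean_elem_iff carrier_T)
qed

text \<open>The idempotents 0 and 1 are central, so the corner entry does not matter here.\<close>

lemma strongly_clean_elem_of_Units:
  assumes abv: "a \<in> carrier A" "v \<in> carrier V" "b \<in> carrier B"
    and u: "a \<in> Units A \<and> b \<in> Units B \<or> a \<ominus>\<^bsub>A\<^esub> \<one>\<^bsub>A\<^esub> \<in> Units A \<and> b \<ominus>\<^bsub>B\<^esub> \<one>\<^bsub>B\<^esub> \<in> Units B"
  shows "strongly_clean_elem T (a, v, b)"
proof -
  have abv': "(a, v, b) \<in> carrier T"
    using abv by (simp add: carrier_T)
  have "(a, v, b) \<ominus>\<^bsub>T\<^esub> \<zero>\<^bsub>T\<^esub> \<in> Units T \<or> (a, v, b) \<ominus>\<^bsub>T\<^esub> \<one>\<^bsub>T\<^esub> \<in> Units T"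
    using u abv by (auto simp: zero_T one_T minus_T Units_T_iff A.minus_eq B.minus_eq)
  moreover have "is_idempotent T \<zero>\<^bsub>T\<^esub>" "is_idempotent T \<one>\<^bsub>T\<^esub>"
    by (simp_all add: is_idempotent_def)
  ultimately show ?thesis
    using abv' unfolding T.strongly_clean_elem_iff[OF abv']
    by (metis T.l_null T.r_null T.l_one T.r_one)
qed

text \<open>Depending on which entry of the diagonal is a nonunit, the very clean decomposition of \<open>r\<close>, that
  of \<open>1 - r\<close>, or a central idempotent yields a strongly clean decomposition of \<open>r\<close>.\<close>

lemma strongly_clean_if_not_two_Units:
  assumes vc: "very_clean T"
    and two: "\<one>\<^bsub>A\<^esub> \<oplus>\<^bsub>A\<^esub> \<one>\<^bsub>A\<^esub> \<notin> Units A \<or> \<one>\<^bsub>B\<^esub> \<oplus>\<^bsub>B\<^esub> \<one>\<^bsub>B\<^esub> \<notin> Units B"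
  shows "strongly_clean T"
  unfolding strongly_clean_def
proof
  fix r assume r: "r \<in> carrier T"
  obtain a v b where r_eq: "r = (a, v, b)"
    by (metis prod_cases3)
  have abv: "a \<in> carrier A" "v \<in> carrier V" "b \<in> carrier B"
    using r r_eq by (auto simp: carrier_T)
  have eq: "\<one>\<^bsub>T\<^esub> \<ominus>\<^bsub>T\<^esub> r = (\<one>\<^bsub>A\<^esub> \<ominus>\<^bsub>A\<^esub> a, \<zero>\<^bsub>V\<^esub> \<ominus>\<^bsub>V\<^esub> v, \<one>\<^bsub>B\<^esub> \<ominus>\<^bsub>B\<^esub> b)"
    using abv by (simp add: r_eq one_T minus_T)
  have key: "strongly_clean_elem T (a', v', b')"
    if "a' \<in> carrier A" "v' \<in> carrier V" "b' \<in> carrier B"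
      "\<one>\<^bsub>A\<^esub> \<oplus>\<^bsub>A\<^esub> \<one>\<^bsub>A\<^esub> \<notin> Units A \<and> b' \<notin> Units B \<or> \<one>\<^bsub>B\<^esub> \<oplus>\<^bsub>B\<^esub> \<one>\<^bsub>B\<^esub> \<notin> Units B \<and> a' \<notin> Units A"
    for a' v' b'
    using vc that by (intro very_clean_elem_imp_strongly_clean_elem)
      (auto simp: very_clean_def carrier_T)
  have flip_A: "\<one>\<^bsub>A\<^esub> \<ominus>\<^bsub>A\<^esub> a \<in> Units A \<longleftrightarrow> a \<ominus>\<^bsub>A\<^esub> \<one>\<^bsub>A\<^esub> \<in> Units A"
    using A.Units_minus_iff[of "a \<ominus>\<^bsub>A\<^esub> \<one>\<^bsub>A\<^esub>"] abv by (simp add: A.minus_add A.minus_eq A.a_comm)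
  have flip_B: "\<one>\<^bsub>B\<^esub> \<ominus>\<^bsub>B\<^esub> b \<in> Units B \<longleftrightarrow> b \<ominus>\<^bsub>B\<^esub> \<one>\<^bsub>B\<^esub> \<in> Units B"
    using B.Units_minus_iff[of "b \<ominus>\<^bsub>B\<^esub> \<one>\<^bsub>B\<^esub>"] abv by (simp add: B.minus_add B.minus_eq B.a_comm)
  consider (self) "\<one>\<^bsub>A\<^esub> \<oplus>\<^bsub>A\<^esub> \<one>\<^bsub>A\<^esub> \<notin> Units A \<and> b \<notin> Units B
        \<or> \<one>\<^bsub>B\<^esub> \<oplus>\<^bsub>B\<^esub> \<one>\<^bsub>B\<^esub> \<notin> Units B \<and> a \<notin> Units A"
    | (flipped) "\<one>\<^bsub>A\<^esub> \<oplus>\<^bsub>A\<^esub> \<one>\<^bsub>A\<^esub> \<notin> Units A \<and> \<one>\<^bsub>B\<^esub> \<ominus>\<^bsub>B\<^esub> b \<notin> Units B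
        \<or> \<one>\<^bsub>B\<^esub> \<oplus>\<^bsub>B\<^esub> \<one>\<^bsub>B\<^esub> \<notin> Units B \<and> \<one>\<^bsub>A\<^esub> \<ominus>\<^bsub>A\<^esub> a \<notin> Units A"
    | (trivial) "a \<in> Units A \<and> b \<in> Units B
        \<or> a \<ominus>\<^bsub>A\<^esub> \<one>\<^bsub>A\<^esub> \<in> Units A \<and> b \<ominus>\<^bsub>B\<^esub> \<one>\<^bsub>B\<^esub> \<in> Units B"
    using two flip_A flip_B A.nonunit_minus_one_Unit B.nonunit_minus_one_Unit abv by blast
  then show "strongly_clean_elem T r"
  proof cases
    case self
    then show ?thesis
      using key abv r_eq by simp
  next
    case flipped
    then have "strongly_clean_elem T (\<one>\<^bsub>T\<^esub> \<ominus>\<^bsub>T\<^esub> r)"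
      using key abv unfolding eq by simp
    then show ?thesis
      using T.strongly_clean_elem_one_minus r by blast
  next
    case trivial
    then show ?thesis
      using strongly_clean_elem_of_Units abv r_eq by simp
  qed
qed

lemma very_clean_if_two_Units:
  assumes two: "\<one>\<^bsub>A\<^esub> \<oplus>\<^bsub>A\<^esub> \<one>\<^bsub>A\<^esub> \<in> Units A" "\<one>\<^bsub>B\<^esub> \<oplus>\<^bsub>B\<^esub> \<one>\<^bsub>B\<^esub> \<in> Units B"
  shows "very_clean T"
  unfolding very_clean_def
proof
  fix r assume r: "r \<in> carrier T"
  obtain a v b where r_eq: "r = (a, v, b)"
    by (metis prod_cases3)
  have abv: "a \<in> carrier A" "v \<in> carrier V" "b \<in> carrier B"
    using r r_eq by (auto simp: carrier_T)
  consider "a \<in> Units A" "b \<in> Units B"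
    | "a \<ominus>\<^bsub>A\<^esub> \<one>\<^bsub>A\<^esub> \<in> Units A" "b \<ominus>\<^bsub>B\<^esub> \<one>\<^bsub>B\<^esub> \<in> Units B"
    | "a \<oplus>\<^bsub>A\<^esub> \<one>\<^bsub>A\<^esub> \<in> Units A" "b \<oplus>\<^bsub>B\<^esub> \<one>\<^bsub>B\<^esub> \<in> Units B"
    using A.minus_or_plus_one_Unit[OF abv(1) two(1)] B.minus_or_plus_one_Unit[OF abv(3) two(2)]
      A.nonunit_minus_one_Unit B.nonunit_minus_one_Unit
      A.nonunit_plus_one_Unit B.nonunit_plus_one_Unit abv by metis
  then have "r \<ominus>\<^bsub>T\<^esub> \<zero>\<^bsub>T\<^esub> \<in> Units T \<or> r \<ominus>\<^bsub>T\<^esub> \<one>\<^bsub>T\<^esub> \<in> Units T \<or> r \<oplus>\<^bsub>T\<^esub> \<one>\<^bsub>T\<^esub> \<in> Units T"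
    by cases (use abv in \<open>simp_all add: r_eq zero_T one_T minus_T add_T Units_T_iff
      A.minus_eq B.minus_eq\<close>)
  moreover have "is_idempotent T \<zero>\<^bsub>T\<^esub>" "is_idempotent T \<one>\<^bsub>T\<^esub>"
    by (simp_all add: is_idempotent_def)
  ultimately show "very_clean_elem T r"
    using r unfolding very_clean_elem_def
    by (metis T.l_null T.r_null T.l_one T.r_one)
qed

end

theorem theorem2p2:
  fixes A :: "('a, 'm) ring_scheme" and B :: "('b, 'n) ring_scheme"
    and V :: "('a, 'b, 'v, 'k) bimodule_scheme"
  assumes "local_ring A" and "local_ring B" and "bimodule A B V"
  shows "very_clean (triangular_ring A B V) \<longleftrightarrow>
    (\<one>\<^bsub>A\<^esub> \<oplus>\<^bsub>A\<^esub> \<one>\<^bsub>A\<^esub> \<in> Units A \<and> \<one>\<^bsub>B\<^esub> \<oplus>\<^bsub>B\<^esub> \<one>\<^bsub>B\<^esub> \<in> Units B) \<or>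
    strongly_clean (triangular_ring A B V)"
proof -
  interpret local_bimodule A B V
    using assms by (simp add: local_bimodule_def)
  show ?thesis
    using very_clean_if_two_Units strongly_clean_if_not_two_Units
      T.strongly_clean_imp_very_clean by blast
qed

end
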